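(* For every positive integer $n$, \[ \sum_{m=1}^{2^{n-1}} g(2m-1)=6^{\,n-1}. \]
   Context: For a positive integer $m$, the chocolate game $C_{m,m}$ is a two-player impartial game on an $m\times m$ chocolate bar of unit cells, exactly one of which is poisoned (known to both players); cells are $(i,j)$ with $1\le i,j\le m$. Players alternately break the current bar along a grid line into two rectangular pieces, eat one and pass the other (always keeping the poisoned cell); a player who receives the $1\times1$ bar loses. A cell is a P-position if with poison there the second player has a winning strategy; $P_{m,m}$ is the set of P-positions. It is known that $(i,j)\in P_{m,m}$ iff $(i-1)\oplus(j-1)\oplus(m-i)\oplus(m-j)=0$ ($\oplus$ = bitwise XOR). Define $g(m)=\#P_{m,m}$. *)

theory Defs
  imports Main
begin

type_synonym cell = "nat \<times> nat"

inductive breaks :: "cell set \<Rightarrow> cell set \<Rightarrow> cell set \<Rightarrow> bool" where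
  rows: "a \<le> k \<Longrightarrow> k < b \<Longrightarrow> c \<le> d \<Longrightarrow>
    breaks ({a..b} \<times> {c..d}) ({a..k} \<times> {c..d}) ({Suc k..b} \<times> {c..d})"
| columns: "a \<le> b \<Longrightarrow> c \<le> k \<Longrightarrow> k < d \<Longrightarrow>
    breaks ({a..b} \<times> {c..d}) ({a..b} \<times> {c..k}) ({a..b} \<times> {Suc k..d})"

text \<open>One piece is eaten; the piece passed on is the one containing the poisoned cell \<open>p\<close>.
  The \<open>1 \<times> 1\<close> bar admits no break, so a player who receives it cannot move and loses.\<close>

definition move :: "cell \<Rightarrow> cell set \<Rightarrow> cell set \<Rightarrow> bool" where
  "move p B B' \<longleftrightarrow> p \<in> B' \<and> (\<exists>E. breaks B B' E \<or> breaks B E B')"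

text \<open>The second player answers each bar \<open>B'\<close> received with \<open>s B'\<close>.  The inductive (least)
  reading says that every play in which the second player does so ends after finitely many
  moves with the first player unable to move.  A strategy depending only on the current bar
  loses no generality, since the rules do not refer to earlier moves.\<close>

inductive wins_with :: "cell \<Rightarrow> (cell set \<Rightarrow> cell set) \<Rightarrow> cell set \<Rightarrow> bool"
  for p :: cell and s :: "cell set \<Rightarrow> cell set" where
  "(\<And>B'. move p B B' \<Longrightarrow> move p B' (s B') \<and> wins_with p s (s B')) \<Longrightarrow> wins_with p s B"

definition second_player_wins :: "cell \<Rightarrow> cell set \<Rightarrow> bool" where
  "second_player_wins p B \<longleftrightarrow> (\<exists>s. wins_with p s B)"

definition square_bar :: "nat \<Rightarrow> cell set" where
  "square_bar m = {1..m} \<times> {1..m}"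

definition P_positions :: "nat \<Rightarrow> cell set" where
  "P_positions m = {p \<in> square_bar m. second_player_wins p (square_bar m)}"

definition g :: "nat \<Rightarrow> nat" where
  "g m = card (P_positions m)"

end

theory Submission
  imports Defs
begin

unbundle bit_operations_syntax

text \<open>A bar with poison at \<open>p\<close> is a Nim position whose four heaps count the rows and columns
  on either side of \<open>p\<close>, so the P-positions are the cells of Nim sum \<open>0\<close>. Writing \<open>A s\<close> for
  \<open>g (s + 1)\<close>, the number of pairs \<open>(a, b)\<close> with \<open>a \<oplus> (s - a) = b \<oplus> (s - b)\<close>, the lowest bits
  give \<open>A (2k + 1) = 4 A k\<close> and \<open>A (2k + 2) = A (k + 1) + A k\<close>; mixed parities do not
  contribute in the second case because \<open>u \<oplus> (k - u)\<close> has the parity of \<open>k\<close>. Summing over a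
  dyadic block, with \<open>A (2^N - 1) = 4^N\<close>, gives two simultaneous linear recurrences.\<close>

section \<open>Nim sums\<close>

lemma xor_double_nat:
  fixes a b :: nat
  shows "(2 * a) XOR (2 * b) = 2 * (a XOR b)"
    and "Suc (2 * a) XOR (2 * b) = Suc (2 * (a XOR b))"
    and "(2 * a) XOR Suc (2 * b) = Suc (2 * (a XOR b))"
    and "Suc (2 * a) XOR Suc (2 * b) = 2 * (a XOR b)"
  by (subst xor_rec; simp)+

text \<open>Bit \<open>k\<close> of \<open>h\<close> is cleared and all higher bits survive, because
  \<open>t\<close> has none above \<open>k\<close>; what happens below \<open>k\<close> cannot make
  up for that loss. Halving both numbers removes the low bits until \<open>t\<close> is 1.\<close>

lemma xor_less_of_top_bit:
  fixes h t :: nat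
  assumes "bit h k" "bit t k" "t < 2 ^ Suc k"
  shows "h XOR t < h"
  using assms
proof (induction k arbitrary: h t)
  case 0
  then have "t = 1" "odd h" by (auto simp: bit_0 less_2_cases_iff)
  then show ?case by (auto elim!: oddE simp: xor_double_nat(4)[of _ 0, simplified])
next
  case (Suc k)
  have "(h div 2) XOR (t div 2) < h div 2"
    using Suc.prems by (intro Suc.IH) (auto simp: bit_Suc)
  then have "(h XOR t) div 2 < h div 2"
    using drop_bit_xor[of 1 h t] by (simp add: drop_bit_eq_div)
  then show ?case using div_le_mono[of h "h XOR t" 2] by linarith
qed

lemma top_bit_exists:
  fixes t :: nat
  assumes "t \<noteq> 0"
  shows "\<exists>k. bit t k \<and> t < 2 ^ Suc k"
  using assms
proof (induction t rule: less_induct)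
  case (less t)
  show ?case
  proof (cases "t = 1")
    case True
    then show ?thesis by (intro exI[of _ 0]) (auto simp: bit_0)
  next
    case False
    then have "t div 2 < t" "t div 2 \<noteq> 0" using less.prems by auto
    then obtain k where "bit (t div 2) k" "t div 2 < 2 ^ Suc k" using less.IH by blast
    then show ?thesis by (intro exI[of _ "Suc k"]) (auto simp: bit_Suc)
  qed
qed

abbreviation nim4 :: "nat \<Rightarrow> nat \<Rightarrow> nat \<Rightarrow> nat \<Rightarrow> nat" where
  "nim4 w x y z \<equiv> w XOR x XOR y XOR z"

lemma xor_eq_0_iff_nat: "x XOR y = 0 \<longleftrightarrow> x = (y :: nat)"
  by (metis xor.assoc xor.left_neutral xor.right_neutral xor_self_eq)

text \<open>The classical winning move of Nim: some heap has the top bit of the Nim sum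
  \<open>t\<close>, and replacing that heap \<open>h\<close> by \<open>h XOR t\<close> both lowers
  it and cancels the sum.\<close>

lemma nim4_reduce:
  assumes "nim4 w x y z \<noteq> 0"
  shows "(\<exists>w'<w. nim4 w' x y z = 0) \<or> (\<exists>x'<x. nim4 w x' y z = 0) \<or>
    (\<exists>y'<y. nim4 w x y' z = 0) \<or> (\<exists>z'<z. nim4 w x y z' = 0)"
proof -
  define t where "t = nim4 w x y z"
  obtain k where k: "bit t k" "t < 2 ^ Suc k"
    using assms top_bit_exists t_def by blast
  have "bit w k \<or> bit x k \<or> bit y k \<or> bit z k"
    using k(1) by (auto simp: t_def bit_xor_iff)
  then have "w XOR t < w \<or> x XOR t < x \<or> y XOR t < y \<or> z XOR t < z"
    using k xor_less_of_top_bit by blast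
  moreover have "nim4 (w XOR t) x y z = 0" "nim4 w (x XOR t) y z = 0"
    "nim4 w x (y XOR t) z = 0" "nim4 w x y (z XOR t) = 0"
    by (rule bit_eqI; auto simp: t_def bit_xor_iff)+
  ultimately show ?thesis by blast
qed

section \<open>The P-positions\<close>

text \<open>Read off from the projections of \<open>B\<close>, since strategies receive a set of
  cells and not its endpoints.\<close>

definition bar_nim :: "cell \<Rightarrow> cell set \<Rightarrow> nat" where
  "bar_nim p B = nim4 (card {x \<in> fst ` B. x < fst p}) (card {x \<in> fst ` B. fst p < x})
     (card {y \<in> snd ` B. y < snd p}) (card {y \<in> snd ` B. snd p < y})"

section \<open>Breaks of a rectangle as changes of one endpoint\<close>

lemma bar_nim_rectangle:
  assumes "(i, j) \<in> {a..b} \<times> {c..d}"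
  shows "bar_nim (i, j) ({a..b} \<times> {c..d}) = nim4 (i - a) (b - i) (j - c) (d - j)"
proof -
  have *: "{x. u \<le> x \<and> x \<le> v \<and> x < m} = {u..<m}" "{x. u \<le> x \<and> x \<le> v \<and> m < x} = {m<..v}"
    if "u \<le> m" "m \<le> v" for u v m :: nat
    using that by auto
  show ?thesis using assms by (auto simp: bar_nim_def *)
qed

lemma rectangle_eq_iff:
  fixes a b c d :: nat
  assumes "i \<in> {a..b}" "j \<in> {c..d}"
  shows "{a..b} \<times> {c..d} = {a'..b'} \<times> {c'..d'} \<longleftrightarrow> a = a' \<and> b = b' \<and> c = c' \<and> d = d'"
  using assms by (auto simp: times_eq_iff Icc_eq_Icc)

lemma move_rectangleE:
  assumes "move (i, j) ({a..b} \<times> {c..d}) B'"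
  obtains a' where "B' = {a'..b} \<times> {c..d}" "a < a'" "i \<in> {a'..b}" "j \<in> {c..d}"
  | b' where "B' = {a..b'} \<times> {c..d}" "b' < b" "i \<in> {a..b'}" "j \<in> {c..d}"
  | c' where "B' = {a..b} \<times> {c'..d}" "c < c'" "i \<in> {a..b}" "j \<in> {c'..d}"
  | d' where "B' = {a..b} \<times> {c..d'}" "d' < d" "i \<in> {a..b}" "j \<in> {c..d'}"
proof -
  obtain E where p: "(i, j) \<in> B'"
    and "breaks ({a..b} \<times> {c..d}) B' E \<or> breaks ({a..b} \<times> {c..d}) E B'"
    using assms by (auto simp: move_def)
  then show thesis
  proof (elim disjE)
    assume "breaks ({a..b} \<times> {c..d}) B' E"
    then show thesis
    proof cases
      case (rows a1 k b1 c1 d1)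
      \<comment> \<open>A product determines its endpoints only if it is nonempty; the corner
        \<open>(a1, c1)\<close> witnesses this.\<close>
      then have "a1 = a \<and> b1 = b \<and> c1 = c \<and> d1 = d"
        using rectangle_eq_iff[of a1 a1 b1 c1 c1 d1 a b c d] by auto
      then show thesis using that(2)[of k] rows p by auto
    next
      case (columns a1 b1 c1 k d1)
      then have "a1 = a \<and> b1 = b \<and> c1 = c \<and> d1 = d"
        using rectangle_eq_iff[of a1 a1 b1 c1 c1 d1 a b c d] by auto
      then show thesis using that(4)[of k] columns p by auto
    qed
  next
    assume "breaks ({a..b} \<times> {c..d}) E B'"
    then show thesis
    proof cases
      case (rows a1 k b1 c1 d1)
      then have "a1 = a \<and> b1 = b \<and> c1 = c \<and> d1 = d"
        using rectangle_eq_iff[of a1 a1 b1 c1 c1 d1 a b c d] by auto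
      then show thesis using that(1)[of "Suc k"] rows p by auto
    next
      case (columns a1 b1 c1 k d1)
      then have "a1 = a \<and> b1 = b \<and> c1 = c \<and> d1 = d"
        using rectangle_eq_iff[of a1 a1 b1 c1 c1 d1 a b c d] by auto
      then show thesis using that(3)[of "Suc k"] columns p by auto
    qed
  qed
qed

lemma move_rectangleI:
  assumes "i \<in> {a'..b'}" "j \<in> {c'..d'}"
  shows "a < a' \<Longrightarrow> move (i, j) ({a..b'} \<times> {c'..d'}) ({a'..b'} \<times> {c'..d'})"
    and "b' < b \<Longrightarrow> move (i, j) ({a'..b} \<times> {c'..d'}) ({a'..b'} \<times> {c'..d'})"
    and "c < c' \<Longrightarrow> move (i, j) ({a'..b'} \<times> {c..d'}) ({a'..b'} \<times> {c'..d'})"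
    and "d' < d \<Longrightarrow> move (i, j) ({a'..b'} \<times> {c'..d}) ({a'..b'} \<times> {c'..d'})"
proof -
  \<comment> \<open>The second piece is kept and starts at \<open>Suc k\<close>, so the break is at
    \<open>k = a' - 1\<close>; \<open>a < a'\<close> makes this subtraction exact.\<close>
  show "move (i, j) ({a..b'} \<times> {c'..d'}) ({a'..b'} \<times> {c'..d'})" if "a < a'"
    using breaks.rows[of a "a' - 1" b' c' d'] assms that by (cases a') (auto simp: move_def)
  show "move (i, j) ({a'..b} \<times> {c'..d'}) ({a'..b'} \<times> {c'..d'})" if "b' < b"
    using breaks.rows[of a' b' b c' d'] assms that by (auto simp: move_def)
  show "move (i, j) ({a'..b'} \<times> {c..d'}) ({a'..b'} \<times> {c'..d'})" if "c < c'"
    using breaks.columns[of a' b' c "c' - 1" d'] assms that by (cases c') (auto simp: move_def)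
  show "move (i, j) ({a'..b'} \<times> {c'..d}) ({a'..b'} \<times> {c'..d'})" if "d' < d"
    using breaks.columns[of a' b' c' d' d] assms that by (auto simp: move_def)
qed

section \<open>Play on bars that contain the poison\<close>

definition bar :: "cell \<Rightarrow> cell set \<Rightarrow> bool" where
  "bar p B \<longleftrightarrow> p \<in> B \<and> (\<exists>a b c d. B = {a..b} \<times> {c..d})"

lemma move_bar:
  assumes "bar p B" "move p B B'"
  shows "bar p B' \<and> card B' < card B"
proof -
  obtain i j where p: "p = (i, j)" by (cases p)
  obtain a b c d where B: "B = {a..b} \<times> {c..d}" using assms by (auto simp: bar_def)
  show ?thesis
    using assms(2) unfolding p B
    by (cases rule: move_rectangleE) (auto simp: bar_def card_cartesian_product)
qed

text \<open>A move changes exactly one heap, while in a zero Nim sum any three heaps determine the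
  fourth.\<close>

lemma move_from_nim_0:
  assumes "bar p B" "move p B B'" "bar_nim p B = 0"
  shows "bar_nim p B' \<noteq> 0"
proof -
  obtain i j where p: "p = (i, j)" by (cases p)
  obtain a b c d where B: "B = {a..b} \<times> {c..d}" using assms by (auto simp: bar_def)
  have *: "nim4 w x y z = 0 \<Longrightarrow> nim4 w' x y z = 0 \<Longrightarrow> w = w'"
    "nim4 w x y z = 0 \<Longrightarrow> nim4 w x' y z = 0 \<Longrightarrow> x = x'"
    "nim4 w x y z = 0 \<Longrightarrow> nim4 w x y' z = 0 \<Longrightarrow> y = y'"
    "nim4 w x y z = 0 \<Longrightarrow> nim4 w x y z' = 0 \<Longrightarrow> z = z'" for w x y z w' x' y' z'
    by (metis xor_eq_0_iff_nat xor.left_commute xor.commute)+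
  show ?thesis
  proof
    assume 0: "bar_nim p B' = 0"
    show False
      using assms(2) unfolding p B
    proof (cases rule: move_rectangleE)
      case (1 a')
      then show ?thesis
        using 0 assms(3) *(1)[of "i - a" "b - i" "j - c" "d - j" "i - a'"]
        by (auto simp: p B bar_nim_rectangle)
    next
      case (2 b')
      then show ?thesis
        using 0 assms(3) *(2)[of "i - a" "b - i" "j - c" "d - j" "b' - i"]
        by (auto simp: p B bar_nim_rectangle)
    next
      case (3 c')
      then show ?thesis
        using 0 assms(3) *(3)[of "i - a" "b - i" "j - c" "d - j" "j - c'"]
        by (auto simp: p B bar_nim_rectangle)
    next
      case (4 d')
      then show ?thesis
        using 0 assms(3) *(4)[of "i - a" "b - i" "j - c" "d - j" "d' - j"]
        by (auto simp: p B bar_nim_rectangle)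
    qed
  qed
qed

text \<open>One break can shrink any single heap to any smaller size \<open>h\<close>, by moving the
  endpoint on that side to distance \<open>h\<close> from the poison. Hence the reducing move of Nim
  is available.\<close>

lemma move_to_nim_0:
  assumes "bar p B" "bar_nim p B \<noteq> 0"
  shows "\<exists>B'. move p B B' \<and> bar_nim p B' = 0"
proof -
  obtain i j where p: "p = (i, j)" by (cases p)
  obtain a b c d where B: "B = {a..b} \<times> {c..d}" and ij: "i \<in> {a..b}" "j \<in> {c..d}"
    using assms p by (auto simp: bar_def)
  have "nim4 (i - a) (b - i) (j - c) (d - j) \<noteq> 0"
    using assms ij by (simp add: p B bar_nim_rectangle)
  from nim4_reduce[OF this] show ?thesis
  proof (elim disjE exE conjE)
    fix h assume h: "h < i - a" "nim4 h (b - i) (j - c) (d - j) = 0"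
    then show ?thesis unfolding p B
      using ij by (intro exI[of _ "{i - h..b} \<times> {c..d}"])
        (auto intro!: move_rectangleI simp: bar_nim_rectangle)
  next
    fix h assume h: "h < b - i" "nim4 (i - a) h (j - c) (d - j) = 0"
    then show ?thesis unfolding p B
      using ij by (intro exI[of _ "{a..i + h} \<times> {c..d}"])
        (auto intro!: move_rectangleI simp: bar_nim_rectangle)
  next
    fix h assume h: "h < j - c" "nim4 (i - a) (b - i) h (d - j) = 0"
    then show ?thesis unfolding p B
      using ij by (intro exI[of _ "{a..b} \<times> {j - h..d}"])
        (auto intro!: move_rectangleI simp: bar_nim_rectangle)
  next
    fix h assume h: "h < d - j" "nim4 (i - a) (b - i) (j - c) h = 0"
    then show ?thesis unfolding p B
      using ij by (intro exI[of _ "{a..b} \<times> {c..j + h}"])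
        (auto intro!: move_rectangleI simp: bar_nim_rectangle)
  qed
qed

text \<open>From a nonzero sum the first player could move to a zero sum. Any reply then makes the
  sum nonzero, but the induction hypothesis says that the reply of \<open>s\<close> has sum
  zero.\<close>

lemma wins_with_imp_nim_0:
  assumes "wins_with p s B" "bar p B"
  shows "bar_nim p B = 0"
  using assms
proof (induction rule: wins_with.induct)
  case (1 B)
  show ?case
  proof (rule ccontr)
    assume "bar_nim p B \<noteq> 0"
    then obtain B' where B': "move p B B'" "bar_nim p B' = 0"
      using move_to_nim_0 1(2) by blast
    then have "bar_nim p (s B') = 0" "bar_nim p (s B') \<noteq> 0"
      using 1 move_bar move_from_nim_0 by blast+
    then show False by simp
  qed
qed

text \<open>The choice is meaningful on bars of nonzero sum, which are the bars the second player
  meets when starting from sum zero.\<close>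

definition nim_reply :: "cell \<Rightarrow> cell set \<Rightarrow> cell set" where
  "nim_reply p B = (SOME B'. move p B B' \<and> bar_nim p B' = 0)"

lemma nim_0_imp_wins_with:
  assumes "bar p B" "bar_nim p B = 0"
  shows "wins_with p (nim_reply p) B"
  using assms
proof (induction "card B" arbitrary: B rule: less_induct)
  case less
  show ?case
  proof
    fix B' assume m: "move p B B'"
    have B': "bar p B'" "card B' < card B" "bar_nim p B' \<noteq> 0"
      using move_bar[OF less(2) m] move_from_nim_0[OF less(2) m less(3)] by auto
    have r: "move p B' (nim_reply p B') \<and> bar_nim p (nim_reply p B') = 0"
      unfolding nim_reply_def using move_to_nim_0[OF B'(1,3)] by (rule someI_ex)
    then show "move p B' (nim_reply p B') \<and> wins_with p (nim_reply p) (nim_reply p B')"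
      using less(1) move_bar[of p B' "nim_reply p B'"] B' by auto
  qed
qed

lemma second_player_wins_iff:
  assumes "bar p B"
  shows "second_player_wins p B \<longleftrightarrow> bar_nim p B = 0"
  using assms wins_with_imp_nim_0 nim_0_imp_wins_with unfolding second_player_wins_def by blast

section \<open>Counting\<close>

definition xor_pairs :: "nat \<Rightarrow> (nat \<times> nat) set" where
  "xor_pairs s = {(a, b). a \<le> s \<and> b \<le> s \<and> a XOR (s - a) = b XOR (s - b)}"

lemma finite_xor_pairs [simp]: "finite (xor_pairs s)"
  by (rule finite_subset[of _ "{..s} \<times> {..s}"]) (auto simp: xor_pairs_def)

text \<open>Shifting coordinates to start at 0 turns the four heaps into \<open>u\<close>,
  \<open>s - u\<close>, \<open>v\<close>, \<open>s - v\<close>; their sum vanishes iff the row pair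
  and the column pair have equal XOR.\<close>

lemma g_Suc: "g (Suc s) = card (xor_pairs s)"
proof -
  have "P_positions (Suc s) = map_prod Suc Suc ` xor_pairs s"
  proof (rule set_eqI)
    fix p :: cell
    obtain i j where p: "p = (i, j)" by (cases p)
    show "p \<in> P_positions (Suc s) \<longleftrightarrow> p \<in> map_prod Suc Suc ` xor_pairs s"
    proof (cases "p \<in> square_bar (Suc s)")
      case True
      then obtain u v where uv: "i = Suc u" "j = Suc v" "u \<le> s" "v \<le> s"
        by (auto simp: p square_bar_def) (metis Suc_le_D Suc_le_mono)
      have "bar p (square_bar (Suc s))"
        using True unfolding bar_def square_bar_def by blast
      then have "p \<in> P_positions (Suc s) \<longleftrightarrow> bar_nim p (square_bar (Suc s)) = 0"
        using True by (simp add: P_positions_def second_player_wins_iff)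
      also have "\<dots> \<longleftrightarrow> nim4 u (s - u) v (s - v) = 0"
        using True uv by (simp add: p square_bar_def bar_nim_rectangle)
      also have "\<dots> \<longleftrightarrow> (u, v) \<in> xor_pairs s"
        using uv xor_eq_0_iff_nat[of "u XOR (s - u)" "v XOR (s - v)"]
        by (simp add: xor_pairs_def xor.assoc)
      also have "\<dots> \<longleftrightarrow> p \<in> map_prod Suc Suc ` xor_pairs s"
        by (auto simp: p uv)
      finally show ?thesis .
    next
      case False
      then show ?thesis
        by (auto simp: P_positions_def square_bar_def xor_pairs_def)
    qed
  qed
  then show ?thesis
    by (auto simp: g_def inj_on_def intro!: card_image)
qed

section \<open>Recurrences from the lowest bits\<close>

lemma even_xor_complement:
  assumes "u \<le> (k :: nat)"
  shows "even (u XOR (k - u)) \<longleftrightarrow> even k"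
  using assms by (auto simp: even_xor_iff)

text \<open>With an odd total, a number and its complement have opposite lowest bits, so the XOR
  ends in 1 either way. The condition only concerns the halves, and the two lowest bits
  \<open>e\<close>, \<open>f\<close> are free.\<close>

lemma card_xor_pairs_odd: "card (xor_pairs (Suc (2 * k))) = 4 * card (xor_pairs k)"
proof -
  let ?f = "\<lambda>((u, v), (e, f)). (2 * u + e, 2 * v + f :: nat)"
  have low: "Suc (2 * k) - 2 * u = Suc (2 * (k - u))" if "u \<le> k" for u
    using that by simp
  have high: "2 * k - 2 * u = 2 * (k - u)" for u by simp
  have xor: "(2 * u + e) XOR (Suc (2 * k) - (2 * u + e)) = Suc (2 * (u XOR (k - u)))"
    if "u \<le> k" "e < 2" for u e
    using that by (auto simp: less_2_cases_iff xor_double_nat low high)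
  have "xor_pairs (Suc (2 * k)) = ?f ` (xor_pairs k \<times> ({..<2} \<times> {..<2}))"
  proof (intro equalityI subsetI)
    fix p assume "p \<in> xor_pairs (Suc (2 * k))"
    then obtain a b where p: "p = (a, b)" "a \<le> Suc (2 * k)" "b \<le> Suc (2 * k)"
      "a XOR (Suc (2 * k) - a) = b XOR (Suc (2 * k) - b)"
      by (auto simp: xor_pairs_def)
    have "a div 2 \<le> k" "b div 2 \<le> k" using p by auto
    then have "(a div 2, b div 2) \<in> xor_pairs k"
      using p xor[of "a div 2" "a mod 2"] xor[of "b div 2" "b mod 2"] by (simp add: xor_pairs_def)
    moreover have "p = ?f ((a div 2, b div 2), (a mod 2, b mod 2))" by (simp add: p)
    ultimately show "p \<in> ?f ` (xor_pairs k \<times> ({..<2} \<times> {..<2}))"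
      by (intro image_eqI[of _ _ "((a div 2, b div 2), (a mod 2, b mod 2))"]) auto
  next
    fix p assume "p \<in> ?f ` (xor_pairs k \<times> ({..<2} \<times> {..<2}))"
    then obtain u v e f where p: "p = (2 * u + e, 2 * v + f)" "(u, v) \<in> xor_pairs k" "e < 2" "f < 2"
      by auto
    then show "p \<in> xor_pairs (Suc (2 * k))"
      using xor[of u e] xor[of v f] by (simp add: xor_pairs_def)
  qed
  moreover have "inj_on ?f (xor_pairs k \<times> ({..<2} \<times> {..<2}))"
    by (rule inj_on_inverseI[where g = "\<lambda>(a, b). ((a div 2, b div 2), (a mod 2, b mod 2))"]) auto
  ultimately show ?thesis by (simp add: card_image card_cartesian_product)
qed

text \<open>With an even total, both lowest bits agree and cancel. Halving leaves total
  \<open>Suc k\<close> for even entries, but \<open>k\<close> for odd ones, where the two lowest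
  bits use up 2 of the total.\<close>

lemma card_xor_pairs_even:
  "card (xor_pairs (2 * Suc k)) = card (xor_pairs (Suc k)) + card (xor_pairs k)"
proof -
  let ?E = "map_prod ((*) 2) ((*) 2) ` xor_pairs (Suc k)"
  let ?O = "map_prod (\<lambda>u. Suc (2 * u)) (\<lambda>u. Suc (2 * u)) ` xor_pairs k"
  have even: "(2 * u) XOR (2 * Suc k - 2 * u) = 2 * (u XOR (Suc k - u))" for u
    by (simp only: xor_double_nat flip: diff_mult_distrib2)
  have odd: "Suc (2 * u) XOR (2 * Suc k - Suc (2 * u)) = 2 * (u XOR (k - u))" if "u \<le> k" for u
  proof -
    have "2 * Suc k - Suc (2 * u) = Suc (2 * (k - u))" using that by simp
    then show ?thesis by (simp only: xor_double_nat)
  qed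
  \<comment> \<open>The two sides have the parities of \<open>Suc k\<close> and
    \<open>k\<close>.\<close>
  have mixed: "u XOR (Suc k - u) \<noteq> v XOR (k - v)" if "u \<le> Suc k" "v \<le> k" for u v
    using even_xor_complement[OF that(1)] even_xor_complement[OF that(2)] by auto
  have "xor_pairs (2 * Suc k) = ?E \<union> ?O"
  proof (intro equalityI subsetI)
    fix p assume "p \<in> xor_pairs (2 * Suc k)"
    then obtain a b where p: "p = (a, b)" "a \<le> 2 * Suc k" "b \<le> 2 * Suc k"
      "a XOR (2 * Suc k - a) = b XOR (2 * Suc k - b)"
      by (auto simp: xor_pairs_def)
    consider u v where "a = 2 * u" "b = 2 * v" | u v where "a = Suc (2 * u)" "b = Suc (2 * v)"
      | u v where "a = 2 * u" "b = Suc (2 * v)" | u v where "a = Suc (2 * u)" "b = 2 * v"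
      by (metis evenE oddE Suc_eq_plus1)
    then show "p \<in> ?E \<union> ?O"
    proof cases
      case (1 u v)
      then have "(u, v) \<in> xor_pairs (Suc k)" using p even[of u] even[of v] by (simp add: xor_pairs_def)
      then show ?thesis using 1 p by force
    next
      case (2 u v)
      then have "(u, v) \<in> xor_pairs k" using p odd[of u] odd[of v] by (simp add: xor_pairs_def)
      then show ?thesis using 2 p by force
    next
      case (3 u v)
      then show ?thesis using p even[of u] odd[of v] mixed[of u v] by simp
    next
      case (4 u v)
      then show ?thesis using p even[of v] odd[of u] mixed[of v u] by simp
    qed
  next
    fix p assume "p \<in> ?E \<union> ?O"
    then consider u v where "p = (2 * u, 2 * v)" "(u, v) \<in> xor_pairs (Suc k)"
      | u v where "p = (Suc (2 * u), Suc (2 * v))" "(u, v) \<in> xor_pairs k" by auto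
    then show "p \<in> xor_pairs (2 * Suc k)"
    proof cases
      case (1 u v)
      then show ?thesis using even[of u] even[of v] by (simp add: xor_pairs_def)
    next
      case (2 u v)
      then show ?thesis using odd[of u] odd[of v] by (simp add: xor_pairs_def)
    qed
  qed
  moreover have "?E \<inter> ?O = {}" by (auto, presburger)
  moreover have "card ?E = card (xor_pairs (Suc k))" "card ?O = card (xor_pairs k)"
    by (auto intro!: card_image simp: inj_on_def)
  ultimately show ?thesis by (simp add: card_Un_disjoint)
qed

section \<open>Sums over dyadic blocks\<close>

lemma xor_pairs_0: "xor_pairs 0 = {(0, 0)}"
  by (auto simp: xor_pairs_def)

text \<open>Subtraction from \<open>2 ^ N - 1\<close> flips all \<open>N\<close> bits, so every pair
  counts; formally the odd recurrence is iterated.\<close>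

lemma card_xor_pairs_pow2: "card (xor_pairs (2 ^ N - 1)) = 4 ^ N"
proof (induction N)
  case (Suc N)
  have "2 ^ Suc N - 1 = Suc (2 * (2 ^ N - 1))"
    using one_le_power[of "2 :: nat" N] unfolding power_Suc by linarith
  then show ?case using Suc card_xor_pairs_odd by simp
qed (simp add: xor_pairs_0)

lemma sum_lessThan_double:
  "(\<Sum>s<2 * M. f s) = (\<Sum>k<M. f (2 * k)) + (\<Sum>k<M. f (Suc (2 * k)) :: nat)"
  by (induction M) auto

text \<open>By the even recurrence each term on the right arises twice on the left, from two
  neighbouring indices. Only the last, for \<open>M\<close>, arises once there and is added
  separately; the term for 0 also arises from \<open>k = 0\<close> itself.\<close>

lemma sum_even_xor_pairs:
  "(\<Sum>k<Suc M. card (xor_pairs (2 * k))) + card (xor_pairs M) = 2 * (\<Sum>k<Suc M. card (xor_pairs k))"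
proof (induction M)
  case 0
  then show ?case by (simp add: xor_pairs_0)
next
  case (Suc M)
  then show ?case using card_xor_pairs_even[of M] by simp
qed

lemma sum_xor_pairs_dyadic:
  "(\<Sum>k<2 ^ N. card (xor_pairs (2 * k))) + 4 ^ N = 2 * (\<Sum>k<2 ^ N. card (xor_pairs k))"
  using sum_even_xor_pairs[of "2 ^ N - 1"] card_xor_pairs_pow2[of N] by simp

text \<open>Splitting by parity, the block sum \<open>T N\<close> satisfies
  \<open>T (N + 1) = (2 * T N - 4 ^ N) + 4 * T N\<close>. The factor 2 in the statement avoids a
  division.\<close>

lemma sum_all_xor_pairs: "2 * (\<Sum>s<2 ^ N. card (xor_pairs s)) = 6 ^ N + 4 ^ N"
proof (induction N)
  case (Suc N)
  have "(\<Sum>s<2 ^ Suc N. card (xor_pairs s)) =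
      (\<Sum>k<2 ^ N. card (xor_pairs (2 * k))) + 4 * (\<Sum>k<2 ^ N. card (xor_pairs k))"
    by (simp add: sum_lessThan_double card_xor_pairs_odd sum_distrib_left)
  then show ?case using Suc sum_xor_pairs_dyadic[of N] by simp
qed (simp add: xor_pairs_0)

theorem theorem4:
  fixes n :: nat
  assumes "n \<ge> 1"
  shows "(\<Sum>m = 1..2 ^ (n - 1). g (2 * m - 1)) = 6 ^ (n - 1)"
proof -
  \<comment> \<open>With \<open>m = k + 1\<close> the side is
    \<open>2 * m - 1 = Suc (2 * k)\<close>, so odd sides correspond to even totals.\<close>
  have "(\<Sum>m = 1..2 ^ (n - 1). g (2 * m - 1)) = (\<Sum>k<2 ^ (n - 1). card (xor_pairs (2 * k)))"
    by (simp add: sum.atLeast1_atMost_eq g_Suc)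
  then show ?thesis
    using sum_xor_pairs_dyadic[of "n - 1"] sum_all_xor_pairs[of "n - 1"] by simp
qed

end
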